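(* Let $G=(B,\circ)$ be a group and let $\varphi,\omega:B\to B^B$ be affine structures on $G$. If, for all $a,b\in B$, (c1) $\varphi_a\omega_b=\omega_b\varphi_a$, and (c2) $\varphi_{b\circ\omega_a(b)^-}=\omega_{\varphi_a\omega_a(b)\circ\omega_a(b)^-}$, then the map $\sigma:B\to B^B$ given by $\sigma_a:=\varphi_a\omega_a$, for every $a\in B$, is an affine structure on $G$.
   Context: For a group $G=(B,\circ)$, $0$ denotes its identity and $a^-$ the inverse of $a$. $B^B$ is the monoid (under composition) of all maps $B\to B$. For $\sigma:B\to B^B$ write $\sigma_a:=\sigma(a)$; juxtaposition of maps is composition. An affine structure on $G$ is a map $\sigma:B\to B^B$ that is a semigroup anti-homomorphism, i.e. $\sigma_{a\circ b}=\sigma_b\sigma_a$ for all $a,b\in B$ (it is not required that $\sigma_0=\mathrm{id}_B$), such that $\sigma_a(b\circ\sigma_b(c))=\sigma_a(b)\circ\sigma_{\sigma_a(b)}\sigma_a(c)$ for all $a,b,c\in B$. *)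

theory Defs
  imports "HOL-Algebra.Group"
begin

text \<open>A map \<open>\<sigma> : B \<rightarrow> B\<^sup>B\<close> on the underlying set \<open>B = carrier G\<close> is represented by a curried
  function, \<open>\<sigma> a b\<close> standing for \<open>\<sigma>\<^sub>a(b)\<close>. Only its values on the carrier matter, so equality of
  maps \<open>B \<rightarrow> B\<close> is expressed pointwise on the carrier. The condition \<open>\<sigma>\<^sub>0 = id\<close> is deliberately
  not imposed.\<close>

definition affine_structure :: "('a, 'm) monoid_scheme \<Rightarrow> ('a \<Rightarrow> 'a \<Rightarrow> 'a) \<Rightarrow> bool" where
  "affine_structure G \<sigma> \<longleftrightarrow>
     \<sigma> \<in> carrier G \<rightarrow> carrier G \<rightarrow> carrier G \<and>
     (\<forall>a\<in>carrier G. \<forall>b\<in>carrier G. \<forall>x\<in>carrier G.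
        \<sigma> (a \<otimes>\<^bsub>G\<^esub> b) x = (\<sigma> b \<circ> \<sigma> a) x) \<and>
     (\<forall>a\<in>carrier G. \<forall>b\<in>carrier G. \<forall>c\<in>carrier G.
        \<sigma> a (b \<otimes>\<^bsub>G\<^esub> \<sigma> b c) = \<sigma> a b \<otimes>\<^bsub>G\<^esub> \<sigma> (\<sigma> a b) (\<sigma> a c))"

end

theory Submission
  imports Defs
begin

text \<open>Write \<open>u = \<omega>\<^sub>a(b)\<close> and \<open>v = \<phi>\<^sub>a(u)\<close>. Condition (c2) reads
  \<open>\<phi>\<^bsub>u\<^sup>-\<^esub> \<phi>\<^sub>b = \<omega>\<^bsub>u\<^sup>-\<^esub> \<omega>\<^sub>v\<close>. Although \<open>\<phi>\<^sub>0\<close> and \<open>\<omega>\<^sub>0\<close> need not be the identity, they act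
  trivially on the images of the \<open>\<phi>\<^sub>x\<close> and \<open>\<omega>\<^sub>x\<close>, so with (c1) one gets
  \<open>\<omega>\<^sub>u \<phi>\<^sub>b = \<omega>\<^sub>u \<phi>\<^sub>u \<omega>\<^bsub>u\<^sup>-\<^esub> \<omega>\<^sub>v = \<phi>\<^sub>u \<omega>\<^sub>v\<close>. This is the form in which the
  affine identity for \<open>\<phi>\<close> applies to the result of the affine identity for \<open>\<omega>\<close>.\<close>

lemma affine_structure_closed:
  assumes "affine_structure G \<sigma>" "a \<in> carrier G" "x \<in> carrier G"
  shows "\<sigma> a x \<in> carrier G"
  using assms by (auto simp: affine_structure_def)

lemma affine_structure_mult:
  fixes G (structure)
  assumes "affine_structure G \<sigma>" "a \<in> carrier G" "b \<in> carrier G" "x \<in> carrier G"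
  shows "\<sigma> (a \<otimes> b) x = \<sigma> b (\<sigma> a x)"
  using assms by (simp add: affine_structure_def)

lemma affine_structure_affine:
  fixes G (structure)
  assumes "affine_structure G \<sigma>" "a \<in> carrier G" "b \<in> carrier G" "c \<in> carrier G"
  shows "\<sigma> a (b \<otimes> \<sigma> b c) = \<sigma> a b \<otimes> \<sigma> (\<sigma> a b) (\<sigma> a c)"
  using assms by (simp add: affine_structure_def)

text \<open>The three maps compose to \<open>\<sigma>\<close> at
  \<open>b \<otimes> inv u \<otimes> u\<close>, which is \<open>b\<close>. Without the innermost
  \<open>\<sigma> b\<close> only \<open>\<sigma> \<one>\<close> would remain.\<close>

lemma (in group) affine_structure_inv_cancel:
  assumes "affine_structure G \<sigma>" "u \<in> carrier G" "b \<in> carrier G" "x \<in> carrier G"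
  shows "\<sigma> u (\<sigma> (inv u) (\<sigma> b x)) = \<sigma> b x"
proof -
  have "\<sigma> u (\<sigma> (inv u) (\<sigma> b x)) = \<sigma> (b \<otimes> inv u \<otimes> u) x"
    using assms by (simp only: affine_structure_mult m_closed inv_closed)
  then show ?thesis
    using assms by (simp add: m_assoc)
qed

theorem theorem5:
  fixes G :: "('a, 'm) monoid_scheme" (structure)
    and \<phi> \<omega> :: "'a \<Rightarrow> 'a \<Rightarrow> 'a"
  assumes "group G"
    and "affine_structure G \<phi>"
    and "affine_structure G \<omega>"
    and c1: "\<And>a b x. \<lbrakk>a \<in> carrier G; b \<in> carrier G; x \<in> carrier G\<rbrakk> \<Longrightarrow>
               (\<phi> a \<circ> \<omega> b) x = (\<omega> b \<circ> \<phi> a) x"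
    and c2: "\<And>a b x. \<lbrakk>a \<in> carrier G; b \<in> carrier G; x \<in> carrier G\<rbrakk> \<Longrightarrow>
               \<phi> (b \<otimes> inv (\<omega> a b)) x = \<omega> (\<phi> a (\<omega> a b) \<otimes> inv (\<omega> a b)) x"
  shows "affine_structure G (\<lambda>a. \<phi> a \<circ> \<omega> a)"
proof -
  interpret group G by fact
  note \<phi> = assms(2) and \<omega> = assms(3)
  note closed [simp] = affine_structure_closed[OF \<phi>] affine_structure_closed[OF \<omega>]
  \<comment> \<open>Oriented to move every \<open>\<phi>\<close> outside every
    \<open>\<omega>\<close>.\<close>
  have comm: "\<omega> b (\<phi> a x) = \<phi> a (\<omega> b x)"
    if "a \<in> carrier G" "b \<in> carrier G" "x \<in> carrier G" for a b x
    using c1[OF that] by simp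
  have mult: "\<phi> (a \<otimes> b) (\<omega> (a \<otimes> b) x) = \<phi> b (\<omega> b (\<phi> a (\<omega> a x)))"
    if "a \<in> carrier G" "b \<in> carrier G" "x \<in> carrier G" for a b x
    using that by (simp add: affine_structure_mult[OF \<phi>] affine_structure_mult[OF \<omega>] comm)
  have affine: "\<phi> a (\<omega> a (b \<otimes> \<phi> b (\<omega> b c))) =
      \<phi> a (\<omega> a b) \<otimes> \<phi> (\<phi> a (\<omega> a b)) (\<omega> (\<phi> a (\<omega> a b)) (\<phi> a (\<omega> a c)))"
    if abc [simp]: "a \<in> carrier G" "b \<in> carrier G" "c \<in> carrier G" for a b c
  proof -
    define u where "u = \<omega> a b"
    define v where "v = \<phi> a u"
    have uv [simp]: "u \<in> carrier G" "v \<in> carrier G"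
      by (simp_all add: u_def v_def)
    have exchange: "\<omega> u (\<phi> b y) = \<phi> u (\<omega> v y)" if [simp]: "y \<in> carrier G" for y
    proof -
      have "\<phi> (inv u) (\<phi> b y) = \<omega> (inv u) (\<omega> v y)"
        using c2[of a b y]
        by (simp add: u_def [symmetric] v_def [symmetric]
            affine_structure_mult[OF \<phi>] affine_structure_mult[OF \<omega>])
      then have "\<phi> b y = \<phi> u (\<omega> (inv u) (\<omega> v y))"
        using affine_structure_inv_cancel[OF \<phi>, of u b y] by simp
      \<comment> \<open>\<open>\<omega> u\<close> passes \<open>\<phi> u\<close> and then cancels
        \<open>\<omega> (inv u)\<close> on the image of \<open>\<omega> v\<close>.\<close>
      then show ?thesis
        by (simp add: comm affine_structure_inv_cancel[OF \<omega>])
    qed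
    \<comment> \<open>With \<open>\<omega> b\<close> outermost, the affine identity for
      \<open>\<omega>\<close> applies.\<close>
    have "\<omega> a (b \<otimes> \<phi> b (\<omega> b c)) = \<omega> a (b \<otimes> \<omega> b (\<phi> b c))"
      by (simp add: comm)
    also have "\<dots> = u \<otimes> \<omega> u (\<omega> a (\<phi> b c))"
      by (simp add: affine_structure_affine[OF \<omega>] u_def)
    also have "\<omega> u (\<omega> a (\<phi> b c)) = \<omega> u (\<phi> b (\<omega> a c))"
      by (simp add: comm)
    \<comment> \<open>The second factor is now a value of \<open>\<phi> u\<close>, as the affine
      identity for \<open>\<phi>\<close> at \<open>a\<close> and \<open>u\<close> requires.\<close>
    also have "\<dots> = \<phi> u (\<omega> v (\<omega> a c))"
      by (simp add: exchange)
    finally have "\<phi> a (\<omega> a (b \<otimes> \<phi> b (\<omega> b c))) = v \<otimes> \<phi> v (\<phi> a (\<omega> v (\<omega> a c)))"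
      by (simp add: affine_structure_affine[OF \<phi>] v_def)
    also have "\<phi> a (\<omega> v (\<omega> a c)) = \<omega> v (\<phi> a (\<omega> a c))"
      by (simp add: comm)
    finally show ?thesis
      by (simp add: u_def v_def)
  qed
  show ?thesis
    unfolding affine_structure_def using mult affine by auto
qed

end
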